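(* Let $(\Omega,\mathcal B)$ be a measurable space, let $\mathcal M$ be a convex class of probability measures on it (containing more than one measure), and let $(X_n)_{n\ge1}$ be the coordinate sequence on the canonical product space $(\Omega^{\mathbb N},\mathcal B^{\otimes\mathbb N})$, whose coordinates are independent under each hypothesis below. Consider the hypotheses $$H_0:\ X_i\stackrel{iid}{\sim}P_0\ \text{for all }i\ge1,\ \text{for some }P_0\in\mathcal M,$$ $$H_1:\ X_i\stackrel{iid}{\sim}P_0\ \text{for }i\le T,\quad X_i\stackrel{iid}{\sim}P_1\ne P_0\ \text{for }i>T,\ \text{for some }T\in\mathbb N,\ P_0,P_1\in\mathcal M.$$ Let $\mathcal A_n:=\sigma(X_1,\dots,X_n)$, and let $(M_n,\mathcal A_n)_{n\ge0}$ be nonnegative and adapted, with deterministic $M_0\le1$ and $M_n=m_n(X_1,\dots,X_n)$ for a measurable function $m_n:\Omega^n\to[0,\infty]$. Assume that, for every $P\in\mathcal M$, $$\mathbb E_{P^{\otimes\infty}}(M_n\mid\mathcal A_{n-1})\le M_{n-1}\quad P^{\otimes\infty}\text{-almost surely},\qquad n\ge1.$$ Then $(M_n,\mathcal A_n)_{n\ge0}$ is a test supermartingale under every distribution in $H_1$.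
   Context: A test supermartingale under a law $\mathbb P$ is a nonnegative process that is a supermartingale under $\mathbb P$ with respect to the stated filtration and has initial value $M_0\le1$. Under a distribution in $H_1$ the sequence has law $P_0^{\otimes T}\otimes P_1^{\otimes\infty}$. *)

theory Defs
  imports "HOL-Probability.Probability"
begin

definition mixture :: "real \<Rightarrow> 'a measure \<Rightarrow> 'a measure \<Rightarrow> 'a measure" where
  "mixture t P Q = measure_of (space P) (sets P)
     (\<lambda>A. ennreal (1 - t) * emeasure P A + ennreal t * emeasure Q A)"

lemma space_mixture [simp]: "space (mixture t P Q) = space P"
  and sets_mixture [simp]: "sets (mixture t P Q) = sets P"
  by (simp_all add: mixture_def)

lemma emeasure_mixture:
  assumes "sets Q = sets P" "A \<in> sets P"
  shows "emeasure (mixture t P Q) A = ennreal (1 - t) * emeasure P A + ennreal t * emeasure Q A"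
proof (rule emeasure_measure_of[OF mixture_def])
  show "sets P \<subseteq> Pow (space P)" by (rule sets.space_closed)
  show "A \<in> sets (mixture t P Q)" using assms by simp
  show "positive (sets (mixture t P Q))
      (\<lambda>A. ennreal (1 - t) * emeasure P A + ennreal t * emeasure Q A)"
    by (simp add: positive_def)
  show "countably_additive (sets (mixture t P Q))
      (\<lambda>A. ennreal (1 - t) * emeasure P A + ennreal t * emeasure Q A)"
  proof (rule countably_additiveI)
    fix F :: "nat \<Rightarrow> 'a set"
    assume F: "range F \<subseteq> sets (mixture t P Q)" "disjoint_family F"
    then have "(\<Sum>i. emeasure P (F i)) = emeasure P (\<Union>i. F i)"
      "(\<Sum>i. emeasure Q (F i)) = emeasure Q (\<Union>i. F i)"
      using assms(1) by (auto intro!: suminf_emeasure)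
    then show "(\<Sum>i. ennreal (1 - t) * emeasure P (F i) + ennreal t * emeasure Q (F i))
        = ennreal (1 - t) * emeasure P (\<Union>i. F i) + ennreal t * emeasure Q (\<Union>i. F i)"
      by (simp add: suminf_add[symmetric])
  qed
qed

text \<open>
  A measurable space is represented by a measure \<open>B\<close> of which only \<open>space B\<close> and
  \<open>sets B\<close> matter.
\<close>

definition convex_prob_class :: "'a measure \<Rightarrow> 'a measure set \<Rightarrow> bool" where
  "convex_prob_class B \<M> \<longleftrightarrow>
     (\<forall>P\<in>\<M>. prob_space P \<and> sets P = sets B) \<and>
     (\<forall>P\<in>\<M>. \<forall>Q\<in>\<M>. \<forall>t\<in>{0..1}. mixture t P Q \<in> \<M>)"

text \<open>
  The coordinates are indexed by \<open>{1..}\<close>, so the \<open>i\<close>-th coordinate map is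
  \<open>\<lambda>\<omega>. \<omega> i\<close> for \<open>i \<ge> 1\<close>.
\<close>

definition path_space :: "'a measure \<Rightarrow> (nat \<Rightarrow> 'a) measure" where
  "path_space B = PiM {1..} (\<lambda>_. B)"

text \<open>
  The \<open>\<sigma>\<close>-algebra generated by the first \<open>n\<close> coordinates. For \<open>n = 0\<close> the generating family is
  empty and the \<open>\<sigma>\<close>-algebra is trivial.
\<close>

definition coord_filtration :: "'a measure \<Rightarrow> nat \<Rightarrow> (nat \<Rightarrow> 'a) measure" where
  "coord_filtration B n = sigma (space (path_space B))
     {(\<lambda>\<omega>. \<omega> i) -` A \<inter> space (path_space B) | i A. i \<in> {1..n} \<and> A \<in> sets B}"

definition iid_law :: "'a measure \<Rightarrow> (nat \<Rightarrow> 'a) measure" where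
  "iid_law P = PiM {1..} (\<lambda>_. P)"

definition change_law :: "nat \<Rightarrow> 'a measure \<Rightarrow> 'a measure \<Rightarrow> (nat \<Rightarrow> 'a) measure" where
  "change_law T P0 P1 = PiM {1..} (\<lambda>i. if i \<le> T then P0 else P1)"

definition H1_laws :: "'a measure set \<Rightarrow> (nat \<Rightarrow> 'a) measure set" where
  "H1_laws \<M> = {change_law T P0 P1 | T P0 P1. P0 \<in> \<M> \<and> P1 \<in> \<M> \<and> P1 \<noteq> P0}"

text \<open>
  Nonnegativity is carried by the type \<^typ>\<open>ennreal\<close>. The constant \<^const>\<open>nn_cond_exp\<close> is
  \<open>0\<close> unless its second argument is a subalgebra and the function is measurable, so these
  conditions are part of the definition.
\<close>

definition test_supermartingale ::
    "'b measure \<Rightarrow> (nat \<Rightarrow> 'b measure) \<Rightarrow> (nat \<Rightarrow> 'b \<Rightarrow> ennreal) \<Rightarrow> bool" where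
  "test_supermartingale Q F M \<longleftrightarrow>
     prob_space Q \<and>
     filtration (space Q) F \<and> (\<forall>n. subalgebra Q (F n)) \<and>
     (\<forall>n. M n \<in> borel_measurable (F n)) \<and>
     (\<forall>n. (\<integral>\<^sup>+\<omega>. M n \<omega> \<partial>Q) < \<infinity>) \<and>
     (\<forall>n\<ge>1. AE \<omega> in Q. nn_cond_exp Q (F (n - 1)) (M n) \<omega> \<le> M (n - 1) \<omega>) \<and>
     (\<forall>\<omega>\<in>space Q. M 0 \<omega> \<le> 1)"

lemma coord_filtration_generator:
  "{(\<lambda>\<omega>. \<omega> i) -` A \<inter> space (path_space B) | i A. i \<in> {1..n} \<and> A \<in> sets B}
     \<subseteq> sets (path_space B)"
proof safe
  fix i A assume "i \<in> {1..n}" "A \<in> sets B"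
  then have "(\<lambda>\<omega>. \<omega> i) \<in> path_space B \<rightarrow>\<^sub>M B"
    unfolding path_space_def by (intro measurable_component_singleton) simp
  then show "(\<lambda>\<omega>. \<omega> i) -` A \<inter> space (path_space B) \<in> sets (path_space B)"
    using \<open>A \<in> sets B\<close> by (rule measurable_sets)
qed

lemma filtration_coord_filtration:
  "filtration (space (path_space B)) (coord_filtration B)"
proof
  fix i j :: nat
  show "space (coord_filtration B i) = space (path_space B)"
    unfolding coord_filtration_def by (rule space_measure_of) blast
  assume "i \<le> j"
  then have "{1..i} \<subseteq> {1..j}" by simp
  then have "{(\<lambda>\<omega>. \<omega> k) -` A \<inter> space (path_space B) | k A. k \<in> {1..i} \<and> A \<in> sets B}
    \<subseteq> {(\<lambda>\<omega>. \<omega> k) -` A \<inter> space (path_space B) | k A. k \<in> {1..j} \<and> A \<in> sets B}"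
    by blast
  then show "sets (coord_filtration B i) \<subseteq> sets (coord_filtration B j)"
    unfolding coord_filtration_def
    by (subst (1 2) sets_measure_of) (blast, blast, rule sigma_sets_subseteq)
qed

lemma subalgebra_coord_filtration:
  assumes "sets Q = sets (path_space B)"
  shows "subalgebra Q (coord_filtration B n)"
proof -
  have G: "{(\<lambda>\<omega>. \<omega> i) -` A \<inter> space (path_space B) | i A. i \<in> {1..n} \<and> A \<in> sets B}
     \<subseteq> Pow (space (path_space B))" by auto
  have "space Q = space (path_space B)"
    using assms by (rule sets_eq_imp_space_eq)
  moreover have "space (coord_filtration B n) = space (path_space B)"
    unfolding coord_filtration_def by (rule space_measure_of[OF G])
  moreover have "sets (coord_filtration B n) \<subseteq> sets (path_space B)"
    unfolding coord_filtration_def sets_measure_of[OF G]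
    by (rule sets.sigma_sets_subset[OF coord_filtration_generator])
  ultimately show ?thesis
    using assms by (simp add: subalgebra_def)
qed

end

theory Submission
  imports Defs
begin

text \<open>
  Let every coordinate have law \<open>P\<close> or \<open>P'\<close>. The mixture \<open>(1 - s) P + s P'\<close> dominates a multiple
  of both, so on finitely many coordinates each null set of its i.i.d. law is null for the given
  product law. The one-step inequality for the mixture therefore holds almost surely
  under that product law, where it gives \<open>(1 - s) \<integral> m\<^sub>n(x, y) P(dy) \<le> m\<^sub>n\<^sub>-\<^sub>1(x)\<close>; now let
  \<open>s\<close> tend to \<open>0\<close> along a sequence.
\<close>

text \<open>Keeps the index sets \<open>{1..n}\<close> and \<open>{1..}\<close> in the form used by
  the definitions, instead of turning \<open>1\<close> into \<open>Suc 0\<close>.\<close>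

declare One_nat_def [simp del]

section \<open>Domination between mixtures and between finite products\<close>

lemma nn_integral_mono_scale_measure:
  assumes "sets N = sets M" "\<And>A. A \<in> sets M \<Longrightarrow> r * emeasure M A \<le> emeasure N A"
    and "f \<in> borel_measurable M"
  shows "r * (\<integral>\<^sup>+x. f x \<partial>M) \<le> (\<integral>\<^sup>+x. f x \<partial>N)"
proof -
  have "scale_measure r M \<le> N"
    using assms(1,2) by (subst le_measure) simp_all
  then have "(\<integral>\<^sup>+x. f x \<partial>scale_measure r M) \<le> (\<integral>\<^sup>+x. f x \<partial>N)"
    using assms(1) by (intro nn_integral_mono_measure) simp_all
  then show ?thesis
    using assms(3) by (simp add: nn_integral_scale_measure)
qed

text \<open>Each weighted component is one summand of the mixture, so it lies below the mixture on
  every event and hence for every nonnegative integrand.\<close>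

lemma nn_integral_mixture_ge:
  assumes "sets Q = sets P" "f \<in> borel_measurable P"
  shows "ennreal (1 - t) * (\<integral>\<^sup>+x. f x \<partial>P) \<le> (\<integral>\<^sup>+x. f x \<partial>mixture t P Q)"
    and "ennreal t * (\<integral>\<^sup>+x. f x \<partial>Q) \<le> (\<integral>\<^sup>+x. f x \<partial>mixture t P Q)"
proof -
  have "f \<in> borel_measurable Q"
    using assms(2) by (simp add: measurable_cong_sets[OF assms(1) refl])
  then show "ennreal t * (\<integral>\<^sup>+x. f x \<partial>Q) \<le> (\<integral>\<^sup>+x. f x \<partial>mixture t P Q)"
    using assms(1) by (intro nn_integral_mono_scale_measure) (simp_all add: emeasure_mixture)
  show "ennreal (1 - t) * (\<integral>\<^sup>+x. f x \<partial>P) \<le> (\<integral>\<^sup>+x. f x \<partial>mixture t P Q)"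
    using assms by (intro nn_integral_mono_scale_measure) (simp_all add: emeasure_mixture)
qed

text \<open>Tonelli peels off one coordinate at a time, and each costs a factor \<open>c\<close>.
  Since the total constant is \<open>c ^ card I\<close>, the bound is tied to finite index sets:
  infinite products of laws that dominate each other coordinatewise can be mutually
  singular.\<close>

lemma nn_integral_PiM_dominated:
  fixes R S :: "'i \<Rightarrow> 'a measure"
  assumes "finite I"
    and R: "\<And>i. prob_space (R i)" and S: "\<And>i. prob_space (S i)"
    and sets_eq: "\<And>i. sets (S i) = sets (R i)"
    and dom: "\<And>i g. g \<in> borel_measurable (R i) \<Longrightarrow> c * (\<integral>\<^sup>+x. g x \<partial>R i) \<le> (\<integral>\<^sup>+x. g x \<partial>S i)"
    and "f \<in> borel_measurable (PiM I R)"
  shows "c ^ card I * (\<integral>\<^sup>+x. f x \<partial>PiM I R) \<le> (\<integral>\<^sup>+x. f x \<partial>PiM I S)"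
  using assms(1,6)
proof (induction I arbitrary: f rule: finite_induct)
  case empty
  then show ?case by (simp add: PiM_empty)
next
  case (insert i I)
  interpret R: product_prob_space R by (rule product_prob_spaceI) (rule R)
  interpret S: product_prob_space S by (rule product_prob_spaceI) (rule S)
  note [measurable] = insert.prems
  have sets_PiM_eq: "sets (PiM J S) = sets (PiM J R)" for J
    by (intro sets_PiM_cong sets_eq refl)
  have inner: "(\<lambda>y. f (x(i := y))) \<in> borel_measurable (R i)" if "x \<in> space (PiM I R)" for x
    using that by measurable
  have outer: "(\<lambda>x. \<integral>\<^sup>+y. f (x(i := y)) \<partial>R i) \<in> borel_measurable (PiM I R)"
    by measurable
  have "c ^ card (insert i I) * (\<integral>\<^sup>+x. f x \<partial>PiM (insert i I) R)
      = c * (c ^ card I * (\<integral>\<^sup>+x. (\<integral>\<^sup>+y. f (x(i := y)) \<partial>R i) \<partial>PiM I R))"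
    using insert.hyps by (simp add: R.product_nn_integral_insert mult.assoc)
  \<comment> \<open>The induction hypothesis replaces \<open>R\<close> by \<open>S\<close> in the
    outer integral; the last factor \<open>c\<close> is spent afterwards on the section in
    coordinate \<open>i\<close>.\<close>
  also have "\<dots> \<le> c * (\<integral>\<^sup>+x. (\<integral>\<^sup>+y. f (x(i := y)) \<partial>R i) \<partial>PiM I S)"
    by (intro mult_left_mono insert.IH outer) simp
  also have "\<dots> = (\<integral>\<^sup>+x. c * (\<integral>\<^sup>+y. f (x(i := y)) \<partial>R i) \<partial>PiM I S)"
    by (rule nn_integral_cmult[symmetric]) (use outer in \<open>simp add: sets_PiM_eq cong: measurable_cong_sets\<close>)
  also have "\<dots> \<le> (\<integral>\<^sup>+x. (\<integral>\<^sup>+y. f (x(i := y)) \<partial>S i) \<partial>PiM I S)"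
    using sets_eq_imp_space_eq[OF sets_PiM_eq[of I]]
    by (intro nn_integral_mono dom inner) simp
  also have "\<dots> = (\<integral>\<^sup>+x. f x \<partial>PiM (insert i I) S)"
    using insert.hyps by (subst S.product_nn_integral_insert)
      (simp_all add: sets_PiM_eq cong: measurable_cong_sets)
  finally show ?case .
qed

text \<open>Domination of integrals, applied to the indicator of an exceptional set, gives absolute
  continuity because the constant \<open>c ^ card I\<close> is not zero.\<close>

lemma AE_PiM_dominated:
  fixes R S :: "'i \<Rightarrow> 'a measure"
  assumes I: "finite I"
    and R: "\<And>i. prob_space (R i)" and S: "\<And>i. prob_space (S i)"
    and sets_eq: "\<And>i. sets (S i) = sets (R i)"
    and dom: "\<And>i g. g \<in> borel_measurable (R i) \<Longrightarrow> c * (\<integral>\<^sup>+x. g x \<partial>R i) \<le> (\<integral>\<^sup>+x. g x \<partial>S i)"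
    and "c > 0"
    and ae: "AE x in PiM I S. P x"
  shows "AE x in PiM I R. P x"
proof -
  have sets_PiM_eq: "sets (PiM I S) = sets (PiM I R)"
    by (intro sets_PiM_cong sets_eq refl)
  from ae obtain N where N: "{x \<in> space (PiM I S). \<not> P x} \<subseteq> N" "emeasure (PiM I S) N = 0"
    "N \<in> sets (PiM I S)"
    by (rule AE_E)
  from N(3) have NR: "N \<in> sets (PiM I R)"
    by (simp add: sets_PiM_eq)
  then have "c ^ card I * emeasure (PiM I R) N \<le> emeasure (PiM I S) N"
    using nn_integral_PiM_dominated[where R = R and S = S and f = "indicator N", OF I R S sets_eq dom]
    by (simp add: sets_PiM_eq)
  also have "\<dots> = 0" by (rule N(2))
  finally have "emeasure (PiM I R) N = 0"
    using \<open>c > 0\<close> by auto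
  then show ?thesis
    using N(1) NR sets_eq_imp_space_eq[OF sets_PiM_eq]
    by (intro AE_I[of _ _ N]) simp_all
qed

section \<open>The coordinate filtration seen through finite products\<close>

text \<open>The first \<open>n\<close> coordinates factor through the restriction map, which gives
  one inclusion; conversely, the components of the restriction map are those coordinates. Questions
  about \<open>coord_filtration B n\<close> thereby move to a finite product, where domination is
  available.\<close>

lemma coord_filtration_eq_vimage_algebra:
  "sets (coord_filtration B n)
    = sets (vimage_algebra (space (path_space B)) (\<lambda>\<omega>. restrict \<omega> {1..n}) (PiM {1..n} (\<lambda>_. B)))"
    (is "_ = sets ?V")
proof
  have generator: "{(\<lambda>\<omega>. \<omega> i) -` A \<inter> space (path_space B) | i A. i \<in> {1..n} \<and> A \<in> sets B}
     \<subseteq> Pow (space (path_space B))" by auto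
  have space: "space (coord_filtration B n) = space (path_space B)"
    unfolding coord_filtration_def by (rule space_measure_of[OF generator])
  have restrict: "(\<lambda>\<omega>. restrict \<omega> {1..n}) \<in> space (path_space B) \<rightarrow> space (PiM {1..n} (\<lambda>_. B))"
    by (auto simp: path_space_def space_PiM)
  show "sets (coord_filtration B n) \<subseteq> sets ?V"
    unfolding coord_filtration_def sets_measure_of[OF generator]
  proof (rule sets.sigma_sets_subset[of _ ?V, unfolded space_vimage_algebra], safe)
    fix i A assume i: "i \<in> {1..n}" and A: "A \<in> sets B"
    have "(\<lambda>\<omega>. restrict \<omega> {1..n} i) \<in> ?V \<rightarrow>\<^sub>M B"
      using measurable_compose[OF measurable_vimage_algebra1[OF restrict]
          measurable_component_singleton[OF i, of "\<lambda>_. B"]] .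
    then have "(\<lambda>\<omega>. \<omega> i) \<in> ?V \<rightarrow>\<^sub>M B"
      using i by simp
    from measurable_sets[OF this A]
    show "(\<lambda>\<omega>. \<omega> i) -` A \<inter> space (path_space B) \<in> sets ?V"
      by simp
  qed
  have "(\<lambda>\<omega>. \<omega> i) \<in> coord_filtration B n \<rightarrow>\<^sub>M B" if "i \<in> {1..n}" for i
  proof (rule measurableI)
    show "\<omega> i \<in> space B" if "\<omega> \<in> space (coord_filtration B n)" for \<omega>
      using that \<open>i \<in> {1..n}\<close> unfolding space by (auto simp: path_space_def space_PiM)
    show "(\<lambda>\<omega>. \<omega> i) -` A \<inter> space (coord_filtration B n) \<in> sets (coord_filtration B n)"
      if "A \<in> sets B" for A
      unfolding space unfolding coord_filtration_def sets_measure_of[OF generator]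
      using that \<open>i \<in> {1..n}\<close> by (intro sigma_sets.Basic) blast
  qed
  then have "(\<lambda>\<omega>. restrict \<omega> {1..n}) \<in> coord_filtration B n \<rightarrow>\<^sub>M PiM {1..n} (\<lambda>_. B)"
    by (intro measurable_restrict)
  from sets_image_in_sets[OF space this]
  show "sets ?V \<subseteq> sets (coord_filtration B n)" .
qed

lemma measurable_restrict_coord_filtration:
  "(\<lambda>\<omega>. restrict \<omega> {1..n}) \<in> coord_filtration B n \<rightarrow>\<^sub>M PiM {1..n} (\<lambda>_. B)"
proof -
  have "(\<lambda>\<omega>. restrict \<omega> {1..n}) \<in> space (path_space B) \<rightarrow> space (PiM {1..n} (\<lambda>_. B))"
    by (auto simp: path_space_def space_PiM)
  from measurable_vimage_algebra1[OF this] show ?thesis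
    by (simp add: measurable_cong_sets[OF coord_filtration_eq_vimage_algebra refl])
qed

lemma coord_filtration_setE:
  assumes "A \<in> sets (coord_filtration B n)"
  obtains A' where "A' \<in> sets (PiM {1..n} (\<lambda>_. B))"
    "A = (\<lambda>\<omega>. restrict \<omega> {1..n}) -` A' \<inter> space (path_space B)"
proof -
  have "(\<lambda>\<omega>. restrict \<omega> {1..n}) \<in> space (path_space B) \<rightarrow> space (PiM {1..n} (\<lambda>_. B))"
    by (auto simp: path_space_def space_PiM)
  from sets_vimage_algebra2[OF this] assms that show thesis
    by (auto simp: coord_filtration_eq_vimage_algebra)
qed

lemma insert_Suc_atLeastAtMost_1: "insert (Suc k) {1..k} = {1..Suc k}"
  by auto

text \<open>This removes the factor \<open>1 - s\<close> left over by the mixture argument, along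
  the sequence of weights chosen there.\<close>

lemma ennreal_le_if_scaled_le:
  fixes a b :: ennreal
  assumes "\<And>j::nat. ennreal (1 - (1 / 2) ^ Suc j) * a \<le> b"
  shows "a \<le> b"
proof -
  have "(\<lambda>j. 1 - (1 / 2) ^ Suc j) \<longlonglongrightarrow> (1::real) - 0"
    by (intro tendsto_diff tendsto_const LIMSEQ_Suc LIMSEQ_realpow_zero) auto
  \<comment> \<open>The factors tend to 1 and not to 0, so the product is continuous at the limit
    even when \<open>a\<close> is infinite.\<close>
  then have "(\<lambda>j. ennreal (1 - (1 / 2) ^ Suc j) * a) \<longlonglongrightarrow> ennreal (1 - 0) * a"
    by (intro tendsto_mult_ennreal tendsto_ennrealI tendsto_const) auto
  then show ?thesis
    using assms by (intro LIMSEQ_le_const2[of _ a b]) auto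
qed

section \<open>Independent coordinates and one-step kernels\<close>

text \<open>Every coordinate may have its own law, so one setting covers both the i.i.d. laws and
  the laws with a change point. The common \<sigma>-algebra makes measurability statements about
  \<open>B\<close> and about \<open>R\<close> interchangeable.\<close>

locale independent_sequence =
  fixes B :: "'a measure" and R :: "nat \<Rightarrow> 'a measure"
  assumes prob_space_R: "\<And>i. prob_space (R i)" and sets_R: "\<And>i. sets (R i) = sets B"
begin

sublocale product_prob_space R "{1..}"
  by (rule product_prob_spaceI) (rule prob_space_R)

abbreviation law :: "(nat \<Rightarrow> 'a) measure" where
  "law \<equiv> PiM {1..} R"

lemma sets_PiM_R: "sets (PiM I R) = sets (PiM I (\<lambda>_. B))"
  by (intro sets_PiM_cong sets_R refl)

lemma borel_measurable_PiM_R: "borel_measurable (PiM I R) = borel_measurable (PiM I (\<lambda>_. B))"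
  by (rule measurable_cong_sets[OF sets_PiM_R refl])

lemma sets_law: "sets law = sets (path_space B)"
  by (simp add: sets_PiM_R path_space_def)

lemma space_law: "space law = space (path_space B)"
  by (rule sets_eq_imp_space_eq[OF sets_law])

sublocale finite_measure_subalgebra law "coord_filtration B n" for n
  by unfold_locales (rule subalgebra_coord_filtration[OF sets_law])

lemma distr_restrict_law: "distr law (PiM {1..n} R) (\<lambda>\<omega>. restrict \<omega> {1..n}) = PiM {1..n} R"
  by (rule distr_PiM_restrict_finite) auto

lemma measurable_restrict_law: "(\<lambda>\<omega>. restrict \<omega> {1..n}) \<in> law \<rightarrow>\<^sub>M PiM {1..n} R"
  by (rule measurable_restrict_subset) auto

lemma nn_integral_law_restrict:
  assumes "f \<in> borel_measurable (PiM {1..n} R)"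
  shows "(\<integral>\<^sup>+\<omega>. f (restrict \<omega> {1..n}) \<partial>law) = (\<integral>\<^sup>+x. f x \<partial>PiM {1..n} R)"
  using nn_integral_distr[OF measurable_restrict_law, of f n] assms
  by (simp add: distr_restrict_law)

lemma AE_law_restrict:
  assumes "{x \<in> space (PiM {1..n} R). P x} \<in> sets (PiM {1..n} R)"
  shows "(AE \<omega> in law. P (restrict \<omega> {1..n})) \<longleftrightarrow> (AE x in PiM {1..n} R. P x)"
  using AE_distr_iff[OF measurable_restrict_law assms] unfolding distr_restrict_law ..

lemma measurable_kernel:
  assumes "f \<in> borel_measurable (PiM {1..Suc k} (\<lambda>_. B))"
  shows "(\<lambda>x. \<integral>\<^sup>+y. f (x(Suc k := y)) \<partial>R (Suc k)) \<in> borel_measurable (PiM {1..k} (\<lambda>_. B))"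
proof -
  have [measurable]: "f \<in> borel_measurable (PiM (insert (Suc k) {1..k}) R)"
    using assms unfolding insert_Suc_atLeastAtMost_1 borel_measurable_PiM_R .
  have "(\<lambda>x. \<integral>\<^sup>+y. f (x(Suc k := y)) \<partial>R (Suc k)) \<in> borel_measurable (PiM {1..k} R)"
    by measurable
  then show ?thesis
    unfolding borel_measurable_PiM_R .
qed

text \<open>Independence enters here: conditioning on the first \<open>k\<close> coordinates amounts
  to integrating coordinate \<open>Suc k\<close> against its own law. The defining identity over
  events of the first \<open>k\<close> coordinates reduces to Tonelli on a finite product.\<close>

lemma nn_cond_exp_coord_filtration:
  assumes f: "f \<in> borel_measurable (PiM {1..Suc k} (\<lambda>_. B))"
    and g: "g \<in> borel_measurable law"
    and g_eq: "\<And>\<omega>. \<omega> \<in> space (path_space B) \<Longrightarrow> g \<omega> = f (restrict \<omega> {1..Suc k})"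
  shows "AE \<omega> in law. (\<integral>\<^sup>+y. f ((restrict \<omega> {1..k})(Suc k := y)) \<partial>R (Suc k))
    = nn_cond_exp law (coord_filtration B k) g \<omega>"
proof (rule nn_cond_exp_charact[OF _ g])
  let ?K = "\<lambda>x. \<integral>\<^sup>+y. f (x(Suc k := y)) \<partial>R (Suc k)"
  show "(\<lambda>\<omega>. ?K (restrict \<omega> {1..k})) \<in> borel_measurable (coord_filtration B k)"
    by (rule measurable_compose[OF measurable_restrict_coord_filtration measurable_kernel[OF f]])
  note Suc_eq = insert_Suc_atLeastAtMost_1[of k]
  have f'[measurable]: "f \<in> borel_measurable (PiM (insert (Suc k) {1..k}) R)"
    using f unfolding Suc_eq borel_measurable_PiM_R .
  have K[measurable]: "?K \<in> borel_measurable (PiM {1..k} R)"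
    by measurable
  fix A assume "A \<in> sets (coord_filtration B k)"
  then obtain A' where A'B: "A' \<in> sets (PiM {1..k} (\<lambda>_. B))"
    and A: "A = (\<lambda>\<omega>. restrict \<omega> {1..k}) -` A' \<inter> space (path_space B)"
    by (rule coord_filtration_setE)
  have A'[measurable]: "A' \<in> sets (PiM {1..k} R)"
    using A'B by (simp add: sets_PiM_R)
  have restrict[measurable]: "(\<lambda>x. restrict x {1..k}) \<in> PiM (insert (Suc k) {1..k}) R \<rightarrow>\<^sub>M PiM {1..k} R"
    by (rule measurable_restrict_subset) auto
  have fA: "(\<lambda>x. f x * indicator A' (restrict x {1..k}))
      \<in> borel_measurable (PiM (insert (Suc k) {1..k}) R)"
    by measurable
  have inner: "(\<lambda>y. f (x(Suc k := y))) \<in> borel_measurable (R (Suc k))"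
    if "x \<in> space (PiM {1..k} R)" for x
    using that by measurable
  \<comment> \<open>The event is rewritten with a double restriction, so that the whole integrand is
    a function of the first \<open>Suc k\<close> coordinates.\<close>
  have "(\<integral>\<^sup>+\<omega>\<in>A. g \<omega> \<partial>law)
      = (\<integral>\<^sup>+\<omega>. f (restrict \<omega> {1..Suc k})
          * indicator A' (restrict (restrict \<omega> {1..Suc k}) {1..k}) \<partial>law)"
    by (rule nn_integral_cong) (auto simp: A g_eq space_law Int_absorb1 split: split_indicator)
  also have "\<dots> = (\<integral>\<^sup>+x. f x * indicator A' (restrict x {1..k}) \<partial>PiM {1..Suc k} R)"
    using fA unfolding Suc_eq by (rule nn_integral_law_restrict)
  also have "\<dots> = (\<integral>\<^sup>+x. (\<integral>\<^sup>+y. f (x(Suc k := y))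
      * indicator A' (restrict (x(Suc k := y)) {1..k}) \<partial>R (Suc k)) \<partial>PiM {1..k} R)"
    unfolding Suc_eq[symmetric] by (rule product_nn_integral_insert) (use fA in auto)
  also have "\<dots> = (\<integral>\<^sup>+x. ?K x * indicator A' x \<partial>PiM {1..k} R)"
  proof (rule nn_integral_cong)
    fix x assume x: "x \<in> space (PiM {1..k} R)"
    \<comment> \<open>Points of the product are extensional, so restricting undoes the update; the
      indicator is then constant in \<open>y\<close> and leaves the inner integral.\<close>
    then have "restrict (x(Suc k := y)) {1..k} = x" for y
      by (auto simp: space_PiM PiE_def extensional_def fun_eq_iff)
    then show "(\<integral>\<^sup>+y. f (x(Suc k := y)) * indicator A' (restrict (x(Suc k := y)) {1..k}) \<partial>R (Suc k))
        = ?K x * indicator A' x"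
      using inner[OF x] by (simp add: nn_integral_multc)
  qed
  also have "\<dots> = (\<integral>\<^sup>+\<omega>. ?K (restrict \<omega> {1..k}) * indicator A' (restrict \<omega> {1..k}) \<partial>law)"
    by (rule nn_integral_law_restrict[symmetric]) measurable
  also have "\<dots> = (\<integral>\<^sup>+\<omega>\<in>A. ?K (restrict \<omega> {1..k}) \<partial>law)"
    by (rule nn_integral_cong) (auto simp: A space_law split: split_indicator)
  finally show "(\<integral>\<^sup>+\<omega>\<in>A. g \<omega> \<partial>law) = (\<integral>\<^sup>+\<omega>\<in>A. ?K (restrict \<omega> {1..k}) \<partial>law)" .
qed

text \<open>Conditional expectations under different path laws are hard to compare, being determined
  only up to null sets. The kernel integral is an explicit version on a finite product; the
  equivalence is read forwards for the i.i.d. laws and backwards for the law with a change.\<close>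

lemma nn_cond_exp_le_iff_kernel_le:
  assumes m: "\<And>n. m n \<in> borel_measurable (PiM {1..n} (\<lambda>_. B))"
    and M: "\<And>n. M n \<in> borel_measurable (coord_filtration B n)"
    and M_eq: "\<And>n \<omega>. \<omega> \<in> space (path_space B) \<Longrightarrow> M n \<omega> = m n (restrict \<omega> {1..n})"
  shows "(AE \<omega> in law. nn_cond_exp law (coord_filtration B k) (M (Suc k)) \<omega> \<le> M k \<omega>)
    \<longleftrightarrow> (AE x in PiM {1..k} R. (\<integral>\<^sup>+y. m (Suc k) (x(Suc k := y)) \<partial>R (Suc k)) \<le> m k x)"
    (is "?L \<longleftrightarrow> (AE x in _. ?K x \<le> _)")
proof -
  have "M (Suc k) \<in> borel_measurable law"
    by (rule measurable_from_subalg[OF subalg M])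
  from nn_cond_exp_coord_filtration[OF m this M_eq]
  have ae: "AE \<omega> in law. ?K (restrict \<omega> {1..k})
      = nn_cond_exp law (coord_filtration B k) (M (Suc k)) \<omega>" .
  have "?L \<longleftrightarrow> (AE \<omega> in law. ?K (restrict \<omega> {1..k}) \<le> m k (restrict \<omega> {1..k}))"
    by (rule eventually_subst, use ae AE_space in eventually_elim) (simp add: M_eq space_law)
  also have "\<dots> \<longleftrightarrow> (AE x in PiM {1..k} R. ?K x \<le> m k x)"
  proof (rule AE_law_restrict)
    have [measurable]: "?K \<in> borel_measurable (PiM {1..k} R)" "m k \<in> borel_measurable (PiM {1..k} R)"
      unfolding borel_measurable_PiM_R using measurable_kernel[OF m] m[of k] .
    show "{x \<in> space (PiM {1..k} R). ?K x \<le> m k x} \<in> sets (PiM {1..k} R)"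
      by measurable
  qed
  finally show ?thesis .
qed

text \<open>Finite expectations come from the one-step inequality itself: they do not increase in
  \<open>n\<close> and start at most at 1.\<close>

lemma test_supermartingaleI:
  assumes M: "\<And>n. M n \<in> borel_measurable (coord_filtration B n)"
    and M_0: "\<And>\<omega>. \<omega> \<in> space (path_space B) \<Longrightarrow> M 0 \<omega> \<le> 1"
    and step: "\<And>k. AE \<omega> in law. nn_cond_exp law (coord_filtration B k) (M (Suc k)) \<omega> \<le> M k \<omega>"
  shows "test_supermartingale law (coord_filtration B) M"
proof -
  have M_law: "M n \<in> borel_measurable law" for n
    by (rule measurable_from_subalg[OF subalg M])
  have "(\<integral>\<^sup>+\<omega>. M n \<omega> \<partial>law) \<le> 1" for n
  proof (induction n)
    case 0
    have "(\<integral>\<^sup>+\<omega>. M 0 \<omega> \<partial>law) \<le> (\<integral>\<^sup>+\<omega>. 1 \<partial>law)"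
      by (rule nn_integral_mono) (simp add: M_0 space_law)
    then show ?case by (simp add: P.emeasure_space_1)
  next
    case (Suc n)
    have "(\<integral>\<^sup>+\<omega>. M (Suc n) \<omega> \<partial>law)
        = (\<integral>\<^sup>+\<omega>. nn_cond_exp law (coord_filtration B n) (M (Suc n)) \<omega> \<partial>law)"
      \<comment> \<open>Testing with the constant 1 shows that conditioning preserves the total
        integral.\<close>
      using nn_cond_exp_intg[of "\<lambda>_. 1" n "M (Suc n)"] M_law by simp
    also have "\<dots> \<le> (\<integral>\<^sup>+\<omega>. M n \<omega> \<partial>law)"
      by (rule nn_integral_mono_AE[OF step])
    finally show ?case using Suc by simp
  qed
  then have "(\<integral>\<^sup>+\<omega>. M n \<omega> \<partial>law) < \<infinity>" for n
    by (rule le_less_trans) simp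
  moreover have "AE \<omega> in law. nn_cond_exp law (coord_filtration B (n - 1)) (M n) \<omega> \<le> M (n - 1) \<omega>"
    if "n \<ge> 1" for n
    using step[of "n - 1"] that by simp
  moreover have "prob_space law"
    by (rule P.prob_space_axioms)
  ultimately show ?thesis
    unfolding test_supermartingale_def
    using subalg M M_0 by (simp add: space_law filtration_coord_filtration)
qed

end

section \<open>From the mixtures to the law with a change\<close>

text \<open>Here \<open>P\<close> is the law of the next coordinate, while earlier coordinates may
  follow \<open>P\<close> or \<open>P'\<close>. The positive weight of both in the mixture controls
  null sets of the past; the weight of \<open>P\<close> close to 1 recovers the kernel of the next
  step.\<close>

lemma kernel_le_of_mixture:
  assumes convex: "convex_prob_class B \<M>" and P: "P \<in> \<M>" "P' \<in> \<M>"
    and R: "\<And>i. R i \<in> {P, P'}" and R_Suc: "R (Suc k) = P"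
    and f: "f \<in> borel_measurable (PiM {1..Suc k} (\<lambda>_. B))"
    and kernel: "\<And>S. S \<in> \<M> \<Longrightarrow>
      AE x in PiM {1..k} (\<lambda>_. S). (\<integral>\<^sup>+y. f (x(Suc k := y)) \<partial>S) \<le> h x"
  shows "AE x in PiM {1..k} R. (\<integral>\<^sup>+y. f (x(Suc k := y)) \<partial>R (Suc k)) \<le> h x"
proof -
  have law_class: "prob_space S" "sets S = sets B" if "S \<in> \<M>" for S
    using convex that by (auto simp: convex_prob_class_def)
  have R_class: "R i \<in> \<M>" for i
    using R[of i] P by auto
  have sets_P': "sets P' = sets P"
    using law_class(2) P by simp
  interpret R: independent_sequence B R
    by (intro independent_sequence.intro law_class R_class)
  \<comment> \<open>The exponent \<open>Suc j\<close> keeps \<open>s j\<close> at most 1/2, the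
    smaller of the two weights, so \<open>s j\<close> is a domination constant for both
    \<open>P\<close> and \<open>P'\<close>.\<close>
  define s where "s j = (1 / 2 :: real) ^ Suc j" for j :: nat
  have s: "0 < s j" "s j \<le> 1 - s j" "s j \<in> {0..1}" for j
    using power_le_one[of "1 / 2 :: real" j] by (auto simp: s_def)
  define S where "S j = mixture (s j) P P'" for j
  have S: "S j \<in> \<M>" for j
    using convex P s(3) unfolding S_def convex_prob_class_def by blast
  have sets_S: "sets (S j) = sets (R i)" for i j
    using law_class(2)[OF S] law_class(2)[OF R_class] by simp
  \<comment> \<open>The inequality for \<open>S j\<close> first holds off a null set of its own
    k-fold product. Only the past is moved to \<open>R\<close>; the inner integral stays with
    respect to \<open>S j\<close>.\<close>
  have S_ae: "AE x in PiM {1..k} R. (\<integral>\<^sup>+y. f (x(Suc k := y)) \<partial>S j) \<le> h x" for j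
  proof (rule AE_PiM_dominated[OF _ _ _ _ _ _ kernel[OF S]])
    fix i and g :: "'a \<Rightarrow> ennreal" assume "g \<in> borel_measurable (R i)"
    then have g: "g \<in> borel_measurable P"
      using law_class(2)[OF R_class, of i] law_class(2)[OF P(1)] by (simp cong: measurable_cong_sets)
    have "ennreal (s j) * (\<integral>\<^sup>+x. g x \<partial>P) \<le> ennreal (1 - s j) * (\<integral>\<^sup>+x. g x \<partial>P)"
      using s(2)[of j] by (intro mult_right_mono ennreal_leI) auto
    then show "ennreal (s j) * (\<integral>\<^sup>+x. g x \<partial>R i) \<le> (\<integral>\<^sup>+x. g x \<partial>S j)"
      using R[of i] nn_integral_mixture_ge[OF sets_P' g, of "s j"]
      unfolding S_def by auto
  qed (use s(1)[of j] law_class(1)[OF S] R.prob_space_R sets_S in auto)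
  have f': "f \<in> borel_measurable (PiM (insert (Suc k) {1..k}) R)"
    using f unfolding insert_Suc_atLeastAtMost_1 R.borel_measurable_PiM_R .
  \<comment> \<open>Countably many weights share one exceptional null set, so the limit can be taken
    at a fixed \<open>x\<close>.\<close>
  have "AE x in PiM {1..k} R. \<forall>j. (\<integral>\<^sup>+y. f (x(Suc k := y)) \<partial>S j) \<le> h x"
    using S_ae by (simp add: AE_all_countable)
  then show ?thesis
    using AE_space
  proof eventually_elim
    case (elim x)
    have inner: "(\<lambda>y. f (x(Suc k := y))) \<in> borel_measurable P"
      using elim(2) f' unfolding R_Suc[symmetric] by measurable
    \<comment> \<open>The contribution of \<open>P'\<close> to the mixture integral is nonnegative
      and is dropped.\<close>
    have "ennreal (1 - s j) * (\<integral>\<^sup>+y. f (x(Suc k := y)) \<partial>P) \<le> h x" for j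
      using nn_integral_mixture_ge(1)[OF sets_P' inner, of "s j"] elim(1)
      unfolding S_def by (meson order_trans)
    then show ?case
      unfolding R_Suc s_def by (rule ennreal_le_if_scaled_le)
  qed
qed

theorem theoremB1:
  fixes B :: "'a measure"
    and \<M> :: "'a measure set"
    and m :: "nat \<Rightarrow> (nat \<Rightarrow> 'a) \<Rightarrow> ennreal"
    and M :: "nat \<Rightarrow> (nat \<Rightarrow> 'a) \<Rightarrow> ennreal"
  assumes convex_class: "convex_prob_class B \<M>"
    and more_than_one: "\<exists>P\<in>\<M>. \<exists>Q\<in>\<M>. P \<noteq> Q"
    and adapted: "\<And>n. M n \<in> borel_measurable (coord_filtration B n)"
    and initial: "\<exists>c\<le>1. \<forall>\<omega>\<in>space (path_space B). M 0 \<omega> = c"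
    and m_measurable: "\<And>n. m n \<in> borel_measurable (PiM {1..n} (\<lambda>_. B))"
    and M_eq: "\<And>n \<omega>. \<omega> \<in> space (path_space B) \<Longrightarrow> M n \<omega> = m n (restrict \<omega> {1..n})"
    and supermartingale: "\<And>P n. P \<in> \<M> \<Longrightarrow> n \<ge> 1 \<Longrightarrow>
      AE \<omega> in iid_law P.
        nn_cond_exp (iid_law P) (coord_filtration B (n - 1)) (M n) \<omega> \<le> M (n - 1) \<omega>"
  shows "\<forall>Q\<in>H1_laws \<M>. test_supermartingale Q (coord_filtration B) M"
proof
  fix Q assume "Q \<in> H1_laws \<M>"
  then obtain T P0 P1 where P: "P0 \<in> \<M>" "P1 \<in> \<M>" and Q: "Q = change_law T P0 P1"
    by (auto simp: H1_laws_def)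
  have law_class: "prob_space S" "sets S = sets B" if "S \<in> \<M>" for S
    using convex_class that by (auto simp: convex_prob_class_def)
  define R where "R i = (if i \<le> T then P0 else P1)" for i
  interpret R: independent_sequence B R
    by (rule independent_sequence.intro) (simp_all add: R_def law_class P)
  \<comment> \<open>The hypothesis is put in kernel form for every \<open>S\<close> in the class, so
    that it can be applied to the mixtures of \<open>P0\<close> and \<open>P1\<close>.\<close>
  have iid: "AE x in PiM {1..k} (\<lambda>_. S). (\<integral>\<^sup>+y. m (Suc k) (x(Suc k := y)) \<partial>S) \<le> m k x"
    if "S \<in> \<M>" for S k
  proof -
    interpret S: independent_sequence B "\<lambda>_. S"
      by (intro independent_sequence.intro law_class that)
    have "AE \<omega> in iid_law S.
        nn_cond_exp (iid_law S) (coord_filtration B k) (M (Suc k)) \<omega> \<le> M k \<omega>"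
      using supermartingale[OF that, of "Suc k"] by simp
    then show ?thesis
      unfolding iid_law_def
      by (rule S.nn_cond_exp_le_iff_kernel_le[where m = m and M = M, THEN iffD1, rotated 3])
        (rule m_measurable adapted M_eq | assumption)+
  qed
  have R_range: "R i \<in> {P0, P1}" "R i \<in> {P1, P0}" for i
    by (simp_all add: R_def)
  have "AE x in PiM {1..k} R. (\<integral>\<^sup>+y. m (Suc k) (x(Suc k := y)) \<partial>R (Suc k)) \<le> m k x" for k
  \<comment> \<open>The split decides which of \<open>P0\<close>, \<open>P1\<close> is the law of
    coordinate \<open>Suc k\<close> and so takes the dominant weight.\<close>
  proof (cases "Suc k \<le> T")
    case True
    then have "R (Suc k) = P0"
      by (simp add: R_def)
    then show ?thesis
      by (rule kernel_le_of_mixture[where R = R and f = "m (Suc k)" and h = "m k",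
             OF convex_class P R_range(1) _ m_measurable iid])
  next
    \<comment> \<open>The past may now contain coordinates of both laws, so its law need not be
      absolutely continuous with respect to either i.i.d. law. The roles of \<open>P0\<close> and
      \<open>P1\<close> are exchanged.\<close>
    case False
    then have "R (Suc k) = P1"
      by (simp add: R_def)
    then show ?thesis
      by (rule kernel_le_of_mixture[where R = R and f = "m (Suc k)" and h = "m k",
             OF convex_class P(2,1) R_range(2) _ m_measurable iid])
  qed
  then have step: "AE \<omega> in R.law.
      nn_cond_exp R.law (coord_filtration B k) (M (Suc k)) \<omega> \<le> M k \<omega>" for k
    by (rule R.nn_cond_exp_le_iff_kernel_le[where m = m and M = M, THEN iffD2, rotated 3])
      (rule m_measurable adapted M_eq | assumption)+
  have "M 0 \<omega> \<le> 1" if "\<omega> \<in> space (path_space B)" for \<omega>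
    using initial that by auto
  then have "test_supermartingale R.law (coord_filtration B) M"
    by (rule R.test_supermartingaleI[OF adapted _ step])
  moreover have "Q = R.law"
    unfolding Q change_law_def R_def ..
  ultimately show "test_supermartingale Q (coord_filtration B) M"
    by (simp only:)
qed

end
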